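(* Let $0<s\le1$ and $k>0$. Given $U^n\in S_N$, the system $$Y^{n,0}=U^n,\quad Y^{n,j}=Y^{n,j-1}+kb_jF\Big(\tfrac{Y^{n,j}+Y^{n,j-1}}2\Big),\ 1\le j\le q,$$ admits a solution $Y^{n,j}\in S_N$, $1\le j\le q$.
   Context: Functions are complex-valued and $2\pi$-periodic. $\widehat u(k)=\frac1{2\pi}\int_{-\pi}^{\pi}u(x)e^{-ikx}dx$; $(-\partial_{xx})^s$ has Fourier symbol $|k|^{2s}$. $N\ge1$ is an integer, $S_N=\mathrm{span}\{e^{ikx}:-N\le k\le N\}$, $P_Nu=\sum_{|k|\le N}\widehat u(k)e^{ikx}$, and $F:S_N\to S_N$, $F(u)=-i(-\partial_{xx})^su+iP_N(|u|^2u)$. For $p\ge1$ the method has $q=3^{p-1}$ stages with nonzero real coefficients $b_1,\dots,b_q$ of Yoshida's triple-jump composition: for $p=1$, $b_1=1$; if $b=(b_1,\dots,b_q)$ is the vector for $p$, the one for $p+1$ is the concatenation $(\gamma b,(1-2\gamma)b,\gamma b)$ with $\gamma=1/(2-2^{1/(2p+1)})$. *)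

theory Defs
  imports "HOL-Analysis.Analysis" "HOL-Library.Function_Algebras"
begin

definition fmode :: "int \<Rightarrow> real \<Rightarrow> complex" where
  "fmode m = (\<lambda>x. exp (\<i> * of_int m * of_real x))"

definition fourier_coeff :: "(real \<Rightarrow> complex) \<Rightarrow> int \<Rightarrow> complex" where
  "fourier_coeff u m =
     1 / (2 * of_real pi) * integral {-pi..pi} (\<lambda>x. u x * exp (- \<i> * of_int m * of_real x))"

text \<open>The span is taken over the complex numbers, hence not the real-linear library constant
  \<^const>\<open>real_vector.span\<close>; addition of functions is pointwise.\<close>

definition trig_space :: "nat \<Rightarrow> (real \<Rightarrow> complex) set" where
  "trig_space N = module.span (\<lambda>(c::complex) f x. c * f x) (fmode ` {- int N..int N})"

definition trig_proj :: "nat \<Rightarrow> (real \<Rightarrow> complex) \<Rightarrow> real \<Rightarrow> complex" where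
  "trig_proj N u = (\<lambda>x. \<Sum>m\<in>{- int N..int N}. fourier_coeff u m * fmode m x)"

text \<open>The operator with Fourier symbol \<open>\<bar>m\<bar> powr (2 * s)\<close>. On trigonometric polynomials,
  the only functions it is applied to below, all but finitely many summands vanish.
  The symbol is zero at \<open>m = 0\<close>, as it should be for \<open>s > 0\<close>.\<close>

definition frac_laplacian :: "real \<Rightarrow> (real \<Rightarrow> complex) \<Rightarrow> real \<Rightarrow> complex" where
  "frac_laplacian s u =
     (\<lambda>x. \<Sum>\<^sub>\<infinity>m\<in>(UNIV::int set).
        of_real (\<bar>of_int m\<bar> powr (2 * s)) * fourier_coeff u m * fmode m x)"

definition nls_field :: "real \<Rightarrow> nat \<Rightarrow> (real \<Rightarrow> complex) \<Rightarrow> real \<Rightarrow> complex" where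
  "nls_field s N u =
     (\<lambda>x. - \<i> * frac_laplacian s u x
          + \<i> * trig_proj N (\<lambda>y. of_real ((cmod (u y))\<^sup>2) * u y) x)"

definition triple_jump_gamma :: "nat \<Rightarrow> real" where
  "triple_jump_gamma p = 1 / (2 - 2 powr (1 / (2 * real p + 1)))"

text \<open>The list \<open>[b\<^sub>1, \<dots>, b\<^sub>q]\<close> for parameter \<open>p \<ge> 1\<close>; the value at \<open>0\<close> is irrelevant.\<close>

fun triple_jump :: "nat \<Rightarrow> real list" where
  "triple_jump 0 = []"
| "triple_jump (Suc 0) = [1]"
| "triple_jump (Suc (Suc n)) =
     (let \<gamma> = triple_jump_gamma (Suc n); b = triple_jump (Suc n)
      in map (\<lambda>c. \<gamma> * c) b @ map (\<lambda>c. (1 - 2 * \<gamma>) * c) b @ map (\<lambda>c. \<gamma> * c) b)"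

lemma length_triple_jump: "p \<ge> 1 \<Longrightarrow> length (triple_jump p) = 3 ^ (p - 1)"
  by (induction p rule: triple_jump.induct) (simp_all add: Let_def)

lemma triple_jump_nonzero: "0 \<notin> set (triple_jump p)"
proof (induction p rule: triple_jump.induct)
  case (3 n)
  have "(2::real) powr (1 / (2 * real (Suc n) + 1)) < 2 powr 1"
    by (intro powr_less_mono) (simp_all add: field_simps)
  then have "triple_jump_gamma (Suc n) \<noteq> 0" "1 - 2 * triple_jump_gamma (Suc n) \<noteq> 0"
    by (auto simp: triple_jump_gamma_def field_simps)
  with 3 show ?case by (auto simp: Let_def)
qed simp_all

interpretation cfun: vector_space "\<lambda>(c::complex) (f::real \<Rightarrow> complex) x. c * f x"
  by unfold_locales (auto simp: fun_eq_iff algebra_simps)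

lemma trig_space_iff:
  "u \<in> trig_space N \<longleftrightarrow> (\<exists>c. u = (\<lambda>x. \<Sum>m\<in>{- int N..int N}. c m * fmode m x))"
proof -
  have sum_pt: "(\<Sum>m\<in>A. (\<lambda>x. c m * fmode m x)) = (\<lambda>x. \<Sum>m\<in>A. c m * fmode m x)"
    for A :: "int set" and c
    by (induction A rule: infinite_finite_induct) (auto simp: fun_eq_iff)
  show ?thesis
  proof
    assume "u \<in> trig_space N"
    then show "\<exists>c. u = (\<lambda>x. \<Sum>m\<in>{- int N..int N}. c m * fmode m x)"
      unfolding trig_space_def
    proof (induction rule: cfun.span_induct_alt)
      case base
      then show ?case by (intro exI[of _ "\<lambda>_. 0"]) (auto simp: fun_eq_iff)
    next
      case (step a f g)
      then obtain m c where m: "m \<in> {- int N..int N}" "f = fmode m"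
        and g: "g = (\<lambda>x. \<Sum>m\<in>{- int N..int N}. c m * fmode m x)" by auto
      have "(\<Sum>l\<in>{- int N..int N}. (c l + (if l = m then a else 0)) * fmode l x) =
          a * f x + g x" for x
        using m by (simp add: g distrib_right sum.distrib if_distrib[of "\<lambda>y. y * _"] cong: if_cong)
      then show ?case
        by (intro exI[of _ "\<lambda>l. c l + (if l = m then a else 0)"]) (auto simp: fun_eq_iff)
    qed
  next
    assume "\<exists>c. u = (\<lambda>x. \<Sum>m\<in>{- int N..int N}. c m * fmode m x)"
    then obtain c where "u = (\<Sum>m\<in>{- int N..int N}. (\<lambda>x. c m * fmode m x))"
      using sum_pt by metis
    moreover have "\<dots> \<in> trig_space N"
      unfolding trig_space_def
      by (rule cfun.span_sum, rule cfun.span_scale, rule cfun.span_base, rule imageI)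
    ultimately show "u \<in> trig_space N" by simp
  qed
qed

end

theory Submission
  imports Defs "HOL-Homology.Brouwer_Degree"
begin

text \<open>With \<open>W = (Y + V) / 2\<close>, one step of the scheme reads \<open>W = V + (\<tau> / 2) F(W)\<close>. In Fourier
  coefficients this asks for a zero of the continuous field \<open>G(W) = V + (\<tau> / 2) F(W) - W\<close> on a
  finite-dimensional space. Since \<open>Re \<langle>F(W), W\<rangle> = 0\<close>, we have
  \<open>Re \<langle>G(W), W\<rangle> = Re \<langle>V, W\<rangle> - \<parallel>W\<parallel>\<^sup>2\<close>, so \<open>G\<close> points inwards on every sphere of radius larger than
  \<open>\<parallel>V\<parallel>\<close>, and a Brouwer argument yields the zero, whatever the size and sign of \<open>\<tau>\<close>.\<close>

section \<open>Zeros of inward-pointing fields from the non-contractibility of spheres\<close>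

text \<open>The dimension depends on \<open>N\<close>, so the library's Brouwer theorem, whose dimension is a type
  parameter, does not apply; the spheres of singular homology are indexed by a natural number.\<close>

lemma exists_zero_inward_field_coords:
  fixes G :: "(nat \<Rightarrow> real) \<Rightarrow> nat \<Rightarrow> real"
  assumes R: "R > 0"
    and cont: "\<And>i. i \<le> n \<Longrightarrow> continuous_on UNIV (\<lambda>x. G x i)"
    and inward: "\<And>x. (\<Sum>i\<le>n. (x i)\<^sup>2) = R\<^sup>2 \<Longrightarrow> (\<Sum>i\<le>n. G x i * x i) \<le> 0"
  obtains x where "\<And>i. i \<le> n \<Longrightarrow> G x i = 0"
proof (rule ccontr)
  assume no: "\<not> thesis"
  \<comment> \<open>This is \<open>nsphere n\<close> in coordinates: the unit sphere in the
    \<open>n + 1\<close> coordinates \<open>0..n\<close>, padded by zeros in the countable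
    product.\<close>
  define S where "S = {x::nat \<Rightarrow> real. (\<Sum>i\<le>n. (x i)\<^sup>2) = 1 \<and> (\<forall>i>n. x i = 0)}"
  \<comment> \<open>The homotopy \<open>h\<close> runs from \<open>x\<close> through \<open>- G (R x)\<close> at \<open>t = 1/2\<close> to \<open>- G 0\<close>. It never
    vanishes: for \<open>t < 1/2\<close> its inner product with \<open>x\<close> is positive, afterwards it is a value of
    \<open>- G\<close>. Normalised, it contracts the sphere to a point.\<close>
  define a r c :: "real \<Rightarrow> real"
    where "a = (\<lambda>t. max 0 (1 - 2 * t))" and "r = (\<lambda>t. min 1 (2 - 2 * t))"
      and "c = (\<lambda>t. min 1 (2 * t))"
  define h :: "real \<times> (nat \<Rightarrow> real) \<Rightarrow> nat \<Rightarrow> real"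
    where "h = (\<lambda>(t, x) i. if i \<le> n then a t * x i - c t * G (\<lambda>j. R * r t * x j) i else 0)"
  define q where "q = (\<lambda>z. sqrt (\<Sum>i\<le>n. (h z i)\<^sup>2))"
  have nz: "\<exists>i\<le>n. G x i \<noteq> 0" for x
    using no that by blast
  have h_nz: "\<exists>i\<le>n. h (t, x) i \<noteq> 0" if t: "0 \<le> t" "t \<le> 1" and x: "x \<in> S" for t x
  proof (cases "t < 1/2")
    case True
    then have *: "a t = 1 - 2 * t" "r t = 1" "c t = 2 * t"
      by (auto simp: a_def r_def c_def)
    have "(\<Sum>i\<le>n. (R * x i)\<^sup>2) = R\<^sup>2"
      using x by (simp add: S_def power_mult_distrib flip: sum_distrib_left)
    then have "(\<Sum>i\<le>n. G (\<lambda>j. R * x j) i * (R * x i)) \<le> 0"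
      by (rule inward)
    also have "(\<Sum>i\<le>n. G (\<lambda>j. R * x j) i * (R * x i)) = R * (\<Sum>i\<le>n. G (\<lambda>j. R * x j) i * x i)"
      by (simp add: sum_distrib_left algebra_simps)
    finally have le: "(\<Sum>i\<le>n. G (\<lambda>j. R * x j) i * x i) \<le> 0"
      using R by (simp add: mult_le_0_iff)
    have "(\<Sum>i\<le>n. h (t, x) i * x i)
        = (1 - 2 * t) * (\<Sum>i\<le>n. (x i)\<^sup>2) - 2 * t * (\<Sum>i\<le>n. G (\<lambda>j. R * x j) i * x i)"
      unfolding sum_distrib_left sum_subtractf[symmetric]
      by (rule sum.cong) (simp_all add: h_def * algebra_simps power2_eq_square)
    also have "\<dots> > 0"
    proof -
      have "2 * t * (\<Sum>i\<le>n. G (\<lambda>j. R * x j) i * x i) \<le> 0"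
        using le t by (simp add: mult_nonneg_nonpos)
      moreover have "(\<Sum>i\<le>n. (x i)\<^sup>2) = 1" using x by (simp add: S_def)
      ultimately show ?thesis using True by simp
    qed
    finally have "(\<Sum>i\<le>n. h (t, x) i * x i) \<noteq> 0" by simp
    then obtain i where "i \<le> n" "h (t, x) i * x i \<noteq> 0"
      by (meson sum.neutral atMost_iff)
    then show ?thesis by auto
  next
    case False
    then have *: "a t = 0" "c t = 1"
      by (auto simp: a_def c_def)
    show ?thesis
      using nz[of "\<lambda>j. R * r t * x j"] by (auto simp: h_def *)
  qed
  have q_pos: "q (t, x) > 0" if "0 \<le> t" "t \<le> 1" "x \<in> S" for t x
  proof -
    from h_nz[OF that] obtain i where i: "i \<le> n" "h (t, x) i \<noteq> 0" by blast
    then have "0 < (\<Sum>i\<le>n. (h (t, x) i)\<^sup>2)"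
      by (intro sum_pos2[of _ i]) auto
    then show ?thesis by (simp add: q_def)
  qed
  have cont_h: "continuous_on ({0..1} \<times> S) (\<lambda>z. h z i)" for i
  proof (cases "i \<le> n")
    case True
    have xj: "continuous_on ({0..1} \<times> S) (\<lambda>z. snd z j)" for j
      by (rule continuous_on_product_then_coordinatewise) (intro continuous_intros)
    have r: "continuous_on ({0..1} \<times> S) (\<lambda>z j. R * r (fst z) * snd z j)"
      unfolding r_def
      by (rule continuous_on_coordinatewise_then_product) (intro continuous_intros xj)
    have "continuous_on ({0..1} \<times> S) (\<lambda>z. G (\<lambda>j. R * r (fst z) * snd z j) i)"
      by (rule continuous_on_compose2[OF cont[OF True] r]) auto
    then show ?thesis
      using True unfolding h_def a_def c_def case_prod_unfold
      by (simp, intro continuous_intros xj) auto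
  next
    case False
    then show ?thesis by (simp add: h_def case_prod_unfold)
  qed
  have q_cont: "continuous_on ({0..1} \<times> S) q"
    unfolding q_def by (intro continuous_intros cont_h)
  define K where "K = (\<lambda>z i. h z i / q z)"
  \<comment> \<open>At \<open>t = 1\<close> both \<open>a\<close> and \<open>r\<close> vanish, so
    the argument \<open>x\<close> drops out of \<open>h\<close> and \<open>K\<close> is constant
    there. The zero function, which lies outside \<open>S\<close>, merely names this
    constant.\<close>
  have "homotopic_with_canon (\<lambda>_. True) S S id (\<lambda>_ i. K (1, \<lambda>_. 0) i)"
  proof (subst homotopic_with, simp, intro exI[of _ K] conjI allI ballI)
    have "continuous_on ({0..1} \<times> S) K"
      unfolding K_def
    proof (rule continuous_on_coordinatewise_then_product, intro continuous_intros cont_h q_cont ballI)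
      fix z :: "real \<times> (nat \<Rightarrow> real)" assume "z \<in> {0..1} \<times> S"
      then show "q z \<noteq> 0" using q_pos[of "fst z" "snd z"] by (cases z) auto
    qed
    moreover have "K (t, x) \<in> S" if "0 \<le> t" "t \<le> 1" "x \<in> S" for t x
    proof -
      have "(\<Sum>i\<le>n. (K (t, x) i)\<^sup>2) = (\<Sum>i\<le>n. (h (t, x) i)\<^sup>2) / (q (t, x))\<^sup>2"
        by (simp add: K_def power_divide sum_divide_distrib)
      also have "(\<Sum>i\<le>n. (h (t, x) i)\<^sup>2) = (q (t, x))\<^sup>2"
        unfolding q_def by (simp add: sum_nonneg)
      finally show ?thesis using q_pos[OF that]
        by (simp add: S_def) (simp add: K_def h_def)
    qed
    ultimately show "continuous_map (prod_topology (top_of_set {0..1}) (top_of_set S)) (top_of_set S) K"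
      by (auto simp flip: subtopology_Times simp: continuous_map_in_subtopology)
    show "K (0, x) = id x" if "x \<in> topspace (top_of_set S)" for x
    proof
      fix i
      have x: "x \<in> S" using that by simp
      then have h: "h (0, x) = x"
        by (auto simp: h_def a_def c_def S_def)
      then have "q (0, x) = 1" using x by (simp add: q_def S_def)
      then show "K (0, x) i = id x i" by (simp add: K_def h)
    qed
    show "K (1, x) = (\<lambda>i. K (1, \<lambda>_. 0) i)" for x
    proof -
      have "h (1, x) = h (1, \<lambda>_. 0)" by (simp add: h_def a_def r_def cong: if_cong)
      then show ?thesis by (simp add: K_def q_def)
    qed
  qed auto
  then have "contractible_space (top_of_set S)"
    unfolding contractible_space_def by blast
  moreover have "nsphere n = top_of_set S"
    by (simp add: nsphere euclidean_product_topology S_def)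
  ultimately show False
    using non_contractible_space_nsphere by metis
qed

text \<open>An enumeration of \<open>A\<close> carries sums over \<open>A\<close> to sums over
  \<open>{..n}\<close>, so the field can be transported to sequences; if \<open>A\<close> is empty
  the conclusion is vacuous.\<close>

lemma exists_zero_inward_field_real:
  fixes G :: "('a \<Rightarrow> real) \<Rightarrow> 'a \<Rightarrow> real"
  assumes A: "finite A" and R: "R > 0"
    and cont: "\<And>a. a \<in> A \<Longrightarrow> continuous_on UNIV (\<lambda>x. G x a)"
    and inward: "\<And>x. (\<Sum>a\<in>A. (x a)\<^sup>2) = R\<^sup>2 \<Longrightarrow> (\<Sum>a\<in>A. G x a * x a) \<le> 0"
  obtains x where "\<And>a. a \<in> A \<Longrightarrow> G x a = 0"
proof (cases "A = {}")
  case False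
  \<comment> \<open>The sphere of dimension \<open>n\<close> has \<open>n + 1\<close> coordinates,
    hence the shift by one.\<close>
  then obtain n where "card A = Suc n"
    using A by (metis card_gt_0_iff gr0_implies_Suc)
  then obtain e where "bij_betw e {..<Suc n} A"
    using A by (metis bij_betw_from_nat_into_finite)
  then have e: "bij_betw e {..n} A" by (simp add: lessThan_Suc_atMost)
  \<comment> \<open>Outside \<open>A\<close> the value of \<open>d\<close> is unspecified. Whatever
    it is, \<open>x \<mapsto> (\<lambda>a. x (d a))\<close> is continuous, and the inward condition
    tests only coordinates in \<open>A\<close>.\<close>
  define d where "d = the_inv_into {..n} e"
  have de: "d (e i) = i" if "i \<le> n" for i
    using e that by (simp add: d_def bij_betw_def the_inv_into_f_f)
  have reindex: "(\<Sum>a\<in>A. f a) = (\<Sum>i\<le>n. f (e i))" for f :: "'a \<Rightarrow> real"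
    by (rule sum.reindex_bij_betw[OF e, symmetric])
  obtain x where x: "\<And>i. i \<le> n \<Longrightarrow> G (\<lambda>a. x (d a)) (e i) = 0"
  proof (rule exists_zero_inward_field_coords[OF R, of n "\<lambda>x i. G (\<lambda>a. x (d a)) (e i)"])
    fix i assume i: "i \<le> n"
    then have "e i \<in> A" using e by (auto simp: bij_betw_def)
    then show "continuous_on UNIV (\<lambda>x. G (\<lambda>a. x (d a)) (e i))"
      by (intro continuous_on_compose2[OF cont] continuous_on_coordinatewise_then_product) auto
  next
    fix x :: "nat \<Rightarrow> real" assume "(\<Sum>i\<le>n. (x i)\<^sup>2) = R\<^sup>2"
    then show "(\<Sum>i\<le>n. G (\<lambda>a. x (d a)) (e i) * x i) \<le> 0"
      using inward[of "\<lambda>a. x (d a)"] by (simp add: reindex de)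
  qed blast
  show ?thesis
  proof (rule that[of "\<lambda>a. x (d a)"])
    fix a assume "a \<in> A"
    then obtain i where "i \<le> n" "a = e i" using e by (auto simp: bij_betw_def)
    then show "G (\<lambda>a. x (d a)) a = 0" using x by simp
  qed
qed (use that in blast)

text \<open>The real part of the Hermitian product is the Euclidean product of the real and
  imaginary parts. Indexing these by \<open>A \<times> UNIV\<close>, with \<open>True\<close> for
  real and \<open>False\<close> for imaginary, reduces the claim to the real case.\<close>

lemma exists_zero_inward_field:
  fixes G :: "('a \<Rightarrow> complex) \<Rightarrow> 'a \<Rightarrow> complex"
  assumes A: "finite A" and R: "R > 0"
    and cont: "\<And>a. a \<in> A \<Longrightarrow> continuous_on UNIV (\<lambda>c. G c a)"
    and inward: "\<And>c. (\<Sum>a\<in>A. (cmod (c a))\<^sup>2) = R\<^sup>2 \<Longrightarrow> Re (\<Sum>a\<in>A. G c a * cnj (c a)) \<le> 0"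
  obtains c where "\<And>a. a \<in> A \<Longrightarrow> G c a = 0"
proof -
  define C where "C = (\<lambda>(x::'a \<times> bool \<Rightarrow> real) a. Complex (x (a, True)) (x (a, False)))"
  define H where "H = (\<lambda>x (a, b). if b then Re (G (C x) a) else Im (G (C x) a))"
  have split: "(\<Sum>z\<in>A \<times> UNIV. f z) = (\<Sum>a\<in>A. f (a, True) + f (a, False))"
    for f :: "'a \<times> bool \<Rightarrow> real"
  proof -
    have "(\<Sum>z\<in>A \<times> UNIV. f z) = (\<Sum>a\<in>A. \<Sum>b\<in>UNIV. f (a, b))"
      by (simp add: sum.cartesian_product)
    then show ?thesis by (simp add: UNIV_bool add.commute)
  qed
  have contC: "continuous_on UNIV C"
    unfolding C_def Complex_eq
    by (rule continuous_on_coordinatewise_then_product) (intro continuous_intros; simp)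
  obtain x where x: "\<And>z. z \<in> A \<times> UNIV \<Longrightarrow> H x z = 0"
  proof (rule exists_zero_inward_field_real[of "A \<times> UNIV" R H])
    fix z :: "'a \<times> bool" assume "z \<in> A \<times> UNIV"
    then have "continuous_on UNIV (\<lambda>x. G (C x) (fst z))"
      by (intro continuous_on_compose2[OF cont contC]) auto
    then show "continuous_on UNIV (\<lambda>x. H x z)"
      by (cases z; cases "snd z") (auto simp: H_def intro: continuous_intros)
  next
    fix x :: "'a \<times> bool \<Rightarrow> real" assume "(\<Sum>z\<in>A \<times> UNIV. (x z)\<^sup>2) = R\<^sup>2"
    then have "(\<Sum>a\<in>A. (cmod (C x a))\<^sup>2) = R\<^sup>2"
      by (simp add: split C_def cmod_power2)
    then show "(\<Sum>z\<in>A \<times> UNIV. H x z * x z) \<le> 0"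
      using inward[of "C x"] by (simp add: split H_def C_def)
  qed (use A R in auto)
  show ?thesis
  proof (rule that[of "C x"])
    fix a assume "a \<in> A"
    then have "H x (a, True) = 0" "H x (a, False) = 0"
      by (simp_all add: x)
    then show "G (C x) a = 0" by (simp add: H_def complex_eq_iff)
  qed
qed


section \<open>Fourier modes and their orthogonality\<close>

lemma continuous_on_fmode [continuous_intros]: "continuous_on S (fmode m)"
  unfolding fmode_def by (intro continuous_intros)

lemma cnj_fmode: "cnj (fmode m x) = fmode (- m) x"
  by (simp add: fmode_def exp_cnj)

lemma fmode_mult: "fmode m x * fmode l x = fmode (m + l) x"
  by (simp add: fmode_def algebra_simps flip: exp_add)

lemma integral_fmode: "integral {-pi..pi} (fmode m) = (if m = 0 then 2 * of_real pi else 0)"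
proof (cases "m = 0")
  case True
  then have "fmode m = (\<lambda>x. 1)" by (simp add: fmode_def)
  then show ?thesis using True by (simp add: scaleR_conv_of_real)
next
  case False
  define F where "F = (\<lambda>x. fmode m x / (\<i> * of_int m))"
  have "(F has_vector_derivative fmode m x) (at x within {-pi..pi})" for x
    unfolding F_def fmode_def using False
    by (auto intro!: derivative_eq_intros simp: has_vector_derivative_def[symmetric]
        intro!: has_vector_derivative_real_field)
  then have "(fmode m has_integral F pi - F (- pi)) {-pi..pi}"
    by (intro fundamental_theorem_of_calculus) auto
  \<comment> \<open>Periodicity makes the boundary values of the antiderivative \<open>F\<close>
    cancel.\<close>
  moreover have "fmode m pi = fmode m (- pi)"
  proof -
    have "fmode m pi = exp (\<i> * of_int m * of_real (- pi) + 2 * of_int m * of_real pi * \<i>)"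
      by (simp add: fmode_def algebra_simps)
    also have "\<dots> = fmode m (- pi) * exp (2 * of_int m * of_real pi * \<i>)"
      by (simp only: fmode_def exp_add)
    also have "exp (2 * of_int m * of_real pi * \<i>) = 1"
      using exp_integer_2pi[of "of_int m"] by simp
    finally show ?thesis by simp
  qed
  ultimately show ?thesis using False by (simp add: F_def integral_unique)
qed

lemma fourier_coeff_eq: "fourier_coeff u m = integral {-pi..pi} (\<lambda>x. u x * fmode (- m) x) / (2 * of_real pi)"
  by (simp add: fourier_coeff_def fmode_def)

text \<open>Orthogonality, applied termwise. The frequencies \<open>f a\<close> may coincide, so the
  formula covers both plain trigonometric polynomials and the cubic expansion indexed by
  triples.\<close>

lemma fourier_coeff_sum_fmode:
  assumes "finite A"
  shows "fourier_coeff (\<lambda>x. \<Sum>a\<in>A. c a * fmode (f a) x) m = (\<Sum>a\<in>A. if f a = m then c a else 0)"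
proof -
  have "integral {-pi..pi} (\<lambda>x. (\<Sum>a\<in>A. c a * fmode (f a) x) * fmode (- m) x)
      = integral {-pi..pi} (\<lambda>x. \<Sum>a\<in>A. c a * fmode (f a - m) x)"
    by (simp add: sum_distrib_right mult.assoc fmode_mult)
  also have "\<dots> = (\<Sum>a\<in>A. integral {-pi..pi} (\<lambda>x. c a * fmode (f a - m) x))"
    using assms
    by (intro integral_sum integrable_continuous_real continuous_intros)
  also have "\<dots> = (\<Sum>a\<in>A. c a * integral {-pi..pi} (fmode (f a - m)))"
    by simp
  also have "\<dots> = (\<Sum>a\<in>A. if f a = m then c a else 0) * (2 * of_real pi)"
    unfolding sum_distrib_right by (rule sum.cong) (auto simp: integral_fmode)
  finally show ?thesis by (simp add: fourier_coeff_eq)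
qed

section \<open>Trigonometric polynomials and the vector field in Fourier coefficients\<close>

definition trig_poly :: "nat \<Rightarrow> (int \<Rightarrow> complex) \<Rightarrow> real \<Rightarrow> complex" where
  "trig_poly N c = (\<lambda>x. \<Sum>m\<in>{- int N..int N}. c m * fmode m x)"

lemma trig_space_eq_range: "trig_space N = range (trig_poly N)"
  by (auto simp: trig_space_iff trig_poly_def)

lemma continuous_on_trig_poly [continuous_intros]: "continuous_on S (trig_poly N c)"
  unfolding trig_poly_def by (intro continuous_intros)

lemma fourier_coeff_trig_poly:
  "fourier_coeff (trig_poly N c) m = (if m \<in> {- int N..int N} then c m else 0)"
  unfolding trig_poly_def fourier_coeff_sum_fmode[OF finite_atLeastAtMost_int]
  by simp

lemma frac_laplacian_trig_poly:
  "frac_laplacian s (trig_poly N c) = trig_poly N (\<lambda>m. of_real (\<bar>of_int m\<bar> powr (2 * s)) * c m)"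
proof
  fix x
  have "frac_laplacian s (trig_poly N c) x = (\<Sum>\<^sub>\<infinity>m\<in>{- int N..int N}.
      of_real (\<bar>of_int m\<bar> powr (2 * s)) * fourier_coeff (trig_poly N c) m * fmode m x)"
    unfolding frac_laplacian_def
    by (rule infsum_cong_neutral) (auto simp: fourier_coeff_trig_poly)
  then show "frac_laplacian s (trig_poly N c) x
      = trig_poly N (\<lambda>m. of_real (\<bar>of_int m\<bar> powr (2 * s)) * c m) x"
    by (simp add: fourier_coeff_trig_poly) (simp add: trig_poly_def)
qed

definition cubic_coeff :: "nat \<Rightarrow> (int \<Rightarrow> complex) \<Rightarrow> int \<Rightarrow> complex" where
  "cubic_coeff N c m =
     fourier_coeff (\<lambda>y. of_real ((cmod (trig_poly N c y))\<^sup>2) * trig_poly N c y) m"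

definition nls_coeff :: "real \<Rightarrow> nat \<Rightarrow> (int \<Rightarrow> complex) \<Rightarrow> int \<Rightarrow> complex" where
  "nls_coeff s N c m = \<i> * (cubic_coeff N c m - of_real (\<bar>of_int m\<bar> powr (2 * s)) * c m)"

text \<open>Both terms are diagonal or already projected in Fourier space, so the field becomes a
  map on coefficients; \<open>trig_poly N\<close> performs the truncation of the cubic term by
  itself.\<close>

lemma nls_field_trig_poly: "nls_field s N (trig_poly N c) = trig_poly N (nls_coeff s N c)"
  unfolding nls_field_def frac_laplacian_trig_poly trig_proj_def cubic_coeff_def[symmetric]
  by (simp add: trig_poly_def nls_coeff_def fun_eq_iff sum_distrib_left algebra_simps sum_negf sum_subtractf)

text \<open>In \<open>w * cnj w * w\<close> conjugation reverses the middle frequency, so a triple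
  contributes at \<open>a - b + d\<close>. This polynomial form yields continuity, while the
  integral in the definition of \<open>cubic_coeff\<close> serves the energy identity.\<close>

lemma cubic_coeff_eq_sum:
  "cubic_coeff N c m = (\<Sum>(a, b, d)\<in>{- int N..int N} \<times> {- int N..int N} \<times> {- int N..int N}.
     if a - b + d = m then c a * cnj (c b) * c d else 0)"
proof -
  define I where "I = {- int N..int N}"
  have "of_real ((cmod (trig_poly N c y))\<^sup>2) * trig_poly N c y
      = (\<Sum>z\<in>I \<times> I \<times> I. (case z of (a, b, d) \<Rightarrow> c a * cnj (c b) * c d) *
          fmode (case z of (a, b, d) \<Rightarrow> a - b + d) y)" for y
  proof -
    have "of_real ((cmod (trig_poly N c y))\<^sup>2) * trig_poly N c y
        = (\<Sum>a\<in>I. c a * fmode a y) * ((\<Sum>b\<in>I. cnj (c b) * fmode (- b) y) * (\<Sum>d\<in>I. c d * fmode d y))"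
      unfolding complex_norm_square trig_poly_def I_def[symmetric]
      by (simp add: cnj_fmode mult.assoc)
    also have "\<dots> = (\<Sum>a\<in>I. \<Sum>b\<in>I. \<Sum>d\<in>I. c a * cnj (c b) * c d * (fmode a y * fmode (- b) y * fmode d y))"
      unfolding sum_product by (simp add: sum_distrib_left algebra_simps)
    also have "\<dots> = (\<Sum>a\<in>I. \<Sum>b\<in>I. \<Sum>d\<in>I. c a * cnj (c b) * c d * fmode (a - b + d) y)"
      by (simp add: fmode_mult)
    finally show ?thesis
      by (simp add: sum.cartesian_product case_prod_unfold)
  qed
  then have "cubic_coeff N c m = (\<Sum>z\<in>I \<times> I \<times> I. if (case z of (a, b, d) \<Rightarrow> a - b + d) = m
      then (case z of (a, b, d) \<Rightarrow> c a * cnj (c b) * c d) else 0)"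
    unfolding cubic_coeff_def by (simp add: fourier_coeff_sum_fmode I_def)
  then show ?thesis by (simp only: I_def case_prod_unfold)
qed

text \<open>Each component is a polynomial in finitely many coordinates and their conjugates, hence
  continuous for the product topology; the frequency condition does not involve
  \<open>c\<close>.\<close>

lemma continuous_on_nls_coeff: "continuous_on UNIV (\<lambda>c. nls_coeff s N c m)"
proof -
  have "continuous_on UNIV (\<lambda>c. if P then c a * cnj (c b) * c d else 0)"
    for P and a b d :: int
    by (cases P) (auto intro!: continuous_intros)
  then show ?thesis
    unfolding nls_coeff_def cubic_coeff_eq_sum case_prod_unfold
    by (intro continuous_intros) simp_all
qed

text \<open>A finite Parseval identity: pairing with a trigonometric polynomial sees only the modes
  of \<open>f\<close> up to \<open>N\<close>, so the projection leaves no trace in the energy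
  identity.\<close>

lemma sum_fourier_coeff_mult_cnj:
  assumes "continuous_on {-pi..pi} f"
  shows "(\<Sum>m\<in>{- int N..int N}. fourier_coeff f m * cnj (c m))
       = integral {-pi..pi} (\<lambda>x. f x * cnj (trig_poly N c x)) / (2 * of_real pi)"
proof -
  have "integral {-pi..pi} (\<lambda>x. f x * cnj (trig_poly N c x))
      = integral {-pi..pi} (\<lambda>x. \<Sum>m\<in>{- int N..int N}. f x * fmode (- m) x * cnj (c m))"
    by (simp add: trig_poly_def cnj_fmode sum_distrib_left algebra_simps)
  also have "\<dots> = (\<Sum>m\<in>{- int N..int N}. integral {-pi..pi} (\<lambda>x. f x * fmode (- m) x * cnj (c m)))"
    using assms by (intro integral_sum integrable_continuous_real continuous_intros) auto
  finally show ?thesis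
    by (simp add: fourier_coeff_eq sum_divide_distrib)
qed

text \<open>The cubic term pairs with \<open>w\<close> to the mean of \<open>\<bar>w\<bar>^4\<close>
  and the symbol term to a weighted sum of squared moduli. Both are real, so the factor
  \<open>\<i>\<close> makes the total purely imaginary.\<close>

lemma Re_sum_nls_coeff: "Re (\<Sum>m\<in>{- int N..int N}. nls_coeff s N c m * cnj (c m)) = 0"
proof -
  let ?w = "trig_poly N c"
  have "(\<Sum>m\<in>{- int N..int N}. cubic_coeff N c m * cnj (c m))
      = integral {-pi..pi} (\<lambda>x. of_real ((cmod (?w x))\<^sup>2) * ?w x * cnj (?w x)) / (2 * of_real pi)"
    unfolding cubic_coeff_def by (intro sum_fourier_coeff_mult_cnj continuous_intros)
  also have "(\<lambda>x. of_real ((cmod (?w x))\<^sup>2) * ?w x * cnj (?w x)) = (\<lambda>x. of_real ((cmod (?w x)) ^ 4))"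
    by (simp add: fun_eq_iff mult.assoc power2_eq_square power4_eq_xxxx flip: complex_norm_square)
  also have "integral {-pi..pi} (\<lambda>x. complex_of_real ((cmod (?w x)) ^ 4))
      = of_real (integral {-pi..pi} (\<lambda>x. (cmod (?w x)) ^ 4))"
    by (intro integral_linear[OF _ bounded_linear_of_real, unfolded o_def]
        integrable_continuous_real continuous_intros)
  finally have cubic: "Im (\<Sum>m\<in>{- int N..int N}. cubic_coeff N c m * cnj (c m)) = 0"
    by simp
  have "(\<Sum>m\<in>{- int N..int N}. nls_coeff s N c m * cnj (c m))
      = \<i> * ((\<Sum>m\<in>{- int N..int N}. cubic_coeff N c m * cnj (c m))
          - of_real (\<Sum>m\<in>{- int N..int N}. \<bar>of_int m\<bar> powr (2 * s) * (cmod (c m))\<^sup>2))"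
    by (simp add: nls_coeff_def sum_distrib_left sum_subtractf algebra_simps
        complex_norm_square del: of_real_power)
  then show ?thesis using cubic by simp
qed

section \<open>The implicit midpoint step and its iteration\<close>

lemma implicit_midpoint_step:
  assumes "V \<in> trig_space N"
  obtains Y where "Y \<in> trig_space N"
    and "Y = (\<lambda>x. V x + of_real \<tau> * nls_field s N (\<lambda>y. (Y y + V y) / 2) x)"
proof -
  define I where "I = {- int N..int N}"
  from assms obtain v where v: "V = trig_poly N v"
    by (auto simp: trig_space_eq_range)
  \<comment> \<open>The summand \<open>1\<close> keeps \<open>R\<close> positive when
    \<open>V = 0\<close>. On the sphere of radius \<open>R\<close>, Young's inequality bounds the
    inner product by half of \<open>(\<Sum>m\<in>I. (cmod (v m))^2) - R^2\<close>, which is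
    negative.\<close>
  define R where "R = sqrt ((\<Sum>m\<in>I. (cmod (v m))\<^sup>2) + 1)"
  define G where "G = (\<lambda>c m. v m + of_real (\<tau> / 2) * nls_coeff s N c m - c m)"
  have R2: "R\<^sup>2 = (\<Sum>m\<in>I. (cmod (v m))\<^sup>2) + 1" and "R > 0"
    unfolding R_def by (auto simp: sum_nonneg intro!: add_nonneg_pos)
  obtain c where c: "\<And>m. m \<in> I \<Longrightarrow> G c m = 0"
  proof (rule exists_zero_inward_field[of I R G])
    show "continuous_on UNIV (\<lambda>c. G c m)" for m
      unfolding G_def by (intro continuous_intros continuous_on_nls_coeff; simp)
  next
    fix c assume c: "(\<Sum>m\<in>I. (cmod (c m))\<^sup>2) = R\<^sup>2"
    have young: "Re (v m * cnj (c m)) \<le> ((cmod (v m))\<^sup>2 + (cmod (c m))\<^sup>2) / 2" for m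
    proof -
      have "Re (v m * cnj (c m)) \<le> cmod (v m) * cmod (c m)"
        using complex_Re_le_cmod[of "v m * cnj (c m)"] by (simp add: norm_mult)
      also have "\<dots> \<le> ((cmod (v m))\<^sup>2 + (cmod (c m))\<^sup>2) / 2"
        using sum_squares_bound[of "cmod (v m)" "cmod (c m)"] by simp
      finally show ?thesis .
    qed
    have "(\<Sum>m\<in>I. G c m * cnj (c m)) = (\<Sum>m\<in>I. v m * cnj (c m))
        + of_real (\<tau> / 2) * (\<Sum>m\<in>I. nls_coeff s N c m * cnj (c m)) - of_real (\<Sum>m\<in>I. (cmod (c m))\<^sup>2)"
      unfolding G_def
      by (simp add: algebra_simps sum.distrib sum_subtractf sum_distrib_left complex_norm_square
          del: of_real_power)
    then have "Re (\<Sum>m\<in>I. G c m * cnj (c m)) = Re (\<Sum>m\<in>I. v m * cnj (c m))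
        + \<tau> / 2 * Re (\<Sum>m\<in>I. nls_coeff s N c m * cnj (c m)) - (\<Sum>m\<in>I. (cmod (c m))\<^sup>2)"
      by (simp only: minus_complex.sel plus_complex.sel times_complex.sel
          Re_complex_of_real Im_complex_of_real mult_zero_left diff_zero)
    \<comment> \<open>The energy identity removes the only term containing \<open>\<tau>\<close>, so
      no smallness of the step enters.\<close>
    also have "\<dots> = (\<Sum>m\<in>I. Re (v m * cnj (c m))) - R\<^sup>2"
      unfolding Re_sum_nls_coeff[of s N c, folded I_def] by (simp add: c Re_sum)
    also have "\<dots> \<le> (\<Sum>m\<in>I. ((cmod (v m))\<^sup>2 + (cmod (c m))\<^sup>2) / 2) - R\<^sup>2"
      by (intro diff_right_mono sum_mono young)
    also have "\<dots> \<le> 0"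
      using R2 by (simp add: c sum.distrib flip: sum_divide_distrib)
    finally show "Re (\<Sum>m\<in>I. G c m * cnj (c m)) \<le> 0" .
  qed (use \<open>R > 0\<close> in \<open>auto simp: I_def\<close>)
  have eq: "2 * c m - v m = v m + of_real \<tau> * nls_coeff s N c m" if "m \<in> I" for m
    using c[OF that] by (simp add: G_def field_simps)
  \<comment> \<open>The zero \<open>c\<close> gives the midpoint, and the new stage is recovered as
    twice the midpoint minus \<open>V\<close>.\<close>
  define Y where "Y = trig_poly N (\<lambda>m. 2 * c m - v m)"
  have "(\<lambda>y. (Y y + V y) / 2) = trig_poly N c"
    by (simp add: Y_def v trig_poly_def fun_eq_iff algebra_simps sum_subtractf sum_distrib_left)
  moreover have "Y x = V x + of_real \<tau> * trig_poly N (nls_coeff s N c) x" for x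
  proof -
    have "Y x = (\<Sum>m\<in>I. (v m + of_real \<tau> * nls_coeff s N c m) * fmode m x)"
      unfolding Y_def trig_poly_def I_def[symmetric] by (rule sum.cong) (simp_all add: eq)
    then show ?thesis
      by (simp add: v trig_poly_def I_def algebra_simps sum.distrib sum_distrib_left)
  qed
  ultimately show ?thesis
    by (intro that[of Y]) (auto simp: nls_field_trig_poly fun_eq_iff trig_space_eq_range Y_def)
qed

theorem proposition3p1:
  fixes s k :: real and N p :: nat and U :: "real \<Rightarrow> complex"
  assumes "N \<ge> 1" and "p \<ge> 1"
    and "0 < s" and "s \<le> 1"
    and "k > 0"
    and "U \<in> trig_space N"
  shows "\<exists>Y :: nat \<Rightarrow> real \<Rightarrow> complex.
           Y 0 = U \<and>
           (\<forall>j\<in>{1..3 ^ (p - 1)}.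
              Y j \<in> trig_space N \<and>
              Y j = (\<lambda>x. Y (j - 1) x
                      + of_real (k * triple_jump p ! (j - 1))
                        * nls_field s N (\<lambda>y. (Y j y + Y (j - 1) y) / 2) x))"
proof -
  \<comment> \<open>Lists are indexed from \<open>0\<close>, so the step from \<open>j\<close> to
    \<open>Suc j\<close> uses the coefficient numbered \<open>j + 1\<close>. The sequence is built
    for all \<open>j\<close>: past the end of the list \<open>!\<close> returns some unspecified
    real, for which a midpoint step still exists.\<close>
  have "\<exists>Y. \<forall>j. (Y j \<in> trig_space N \<and> (j = 0 \<longrightarrow> Y j = U)) \<and>
      Y (Suc j) = (\<lambda>x. Y j x + of_real (k * triple_jump p ! j)
        * nls_field s N (\<lambda>y. (Y (Suc j) y + Y j y) / 2) x)"
  proof (rule dependent_nat_choice)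
    fix V :: "real \<Rightarrow> complex" and j :: nat assume "V \<in> trig_space N \<and> (j = 0 \<longrightarrow> V = U)"
    then obtain Y where "Y \<in> trig_space N"
      "Y = (\<lambda>x. V x + of_real (k * triple_jump p ! j) * nls_field s N (\<lambda>y. (Y y + V y) / 2) x)"
      using implicit_midpoint_step by metis
    then show "\<exists>Y. (Y \<in> trig_space N \<and> (Suc j = 0 \<longrightarrow> Y = U)) \<and>
        Y = (\<lambda>x. V x + of_real (k * triple_jump p ! j)
          * nls_field s N (\<lambda>y. (Y y + V y) / 2) x)"
      by blast
  qed (use assms in auto)
  then obtain Y where Y: "\<And>j. Y j \<in> trig_space N" "Y 0 = U"
    "\<And>j. Y (Suc j) = (\<lambda>x. Y j x + of_real (k * triple_jump p ! j)
        * nls_field s N (\<lambda>y. (Y (Suc j) y + Y j y) / 2) x)"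
    by blast
  show ?thesis
  proof (intro exI[of _ Y] conjI ballI Y)
    fix j assume "j \<in> {1..3 ^ (p - 1) :: nat}"
    then obtain i where "j = Suc i" by (metis atLeastAtMost_iff Suc_le_D One_nat_def)
    then show "Y j = (\<lambda>x. Y (j - 1) x + of_real (k * triple_jump p ! (j - 1))
        * nls_field s N (\<lambda>y. (Y j y + Y (j - 1) y) / 2) x)"
      using Y(3)[of i] by simp
  qed
qed

end
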